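(* Let $n\ge3$ and let $k\in\{1,2,\cdots,n\}$. Then (i) $$E_n^{(k)}I_n=\frac{n(n-1)}4-\frac{k-1}6n-\frac{k^2-k-1}{12}+\frac{\frac{(-1)^{n-k}}{(n-k)!}}{\sum_{l=0}^{n-k}\frac{(-1)^l}{l!}}\left(\frac{n-k-1}{12}\right)=\frac{n(n-1)}4-\frac{k-1}6n-\frac{k^2-k-1}{12}+O\left(\frac1{(n-k-1)!}\right).$$ (ii) For $1\le i<j\le n$, $$P_n^{(k)}(\sigma^{-1}_i<\sigma^{-1}_j)=\frac12+\frac1{2n(n-1)(n-2)}\Big(\big(2(k-1)(j-i)+k^2-3k+1\big)n-2(k^2-k-1)(j-i)\Big)+O\left(\frac1{(n-k)!}\right).$$
   Context: Let $[n]=\{1,\dots,n\}$ and let $S_n$ be the set of permutations of $[n]$, written in one-line notation as $\sigma=\sigma_1\cdots\sigma_n$. Let $P_n$ denote the uniform probability measure on $S_n$. For $i\in[n]$, $\sigma^{-1}_i$ denotes the position of the number $i$ in the permutation $\sigma$. The number of inversions of $\sigma\in S_n$ is $$I_n(\sigma)=\sum_{1\le i<j\le n}1_{\{\sigma_j<\sigma_i\}}=\sum_{1\le i<j\le n}1_{\{\sigma^{-1}_j<\sigma^{-1}_i\}}.$$ Let $D_{n;k}=\{\sigma\in S_n: |\{i\in[n]:\sigma_i=i\}|=k\}$ be the set of permutations in $S_n$ with exactly $k$ fixed points. Let $P_n^{(k)}$ denote the uniform probability measure on $D_{n;k}$, that is, $P_n^{(k)}(A)=\frac{P_n(A\cap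 D_{n;k})}{P_n(D_{n;k})}$ for $A\subset S_n$, and let $E_n^{(k)}$ denote the expectation with respect to $P_n^{(k)}$.
   Formalization: The case k = n-1 is excluded, since no permutation of [n] has exactly n-1 fixed points and P_n^{(k)} is then undefined; for k = n the undefined error term O(1/(n-k-1)!) = O(1/(-1)!) in (i) is read as O(1). *)

theory Defs
  imports "HOL-Probability.Probability" "HOL-Combinatorics.Permutations"
begin

definition perms :: "nat \<Rightarrow> (nat \<Rightarrow> nat) set" where
  "perms n = {\<sigma>. \<sigma> permutes {1..n}}"

definition perm_measure :: "nat \<Rightarrow> (nat \<Rightarrow> nat) pmf" where
  "perm_measure n = pmf_of_set (perms n)"

definition inversions :: "nat \<Rightarrow> (nat \<Rightarrow> nat) \<Rightarrow> nat" where
  "inversions n \<sigma> = (\<Sum>j\<in>{1..n}. \<Sum>i\<in>{1..<j}. of_bool (\<sigma> j < \<sigma> i))"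

definition fixed_perms :: "nat \<Rightarrow> nat \<Rightarrow> (nat \<Rightarrow> nat) set" where
  "fixed_perms n k = {\<sigma> \<in> perms n. card {i \<in> {1..n}. \<sigma> i = i} = k}"

text \<open>Meaningful only when \<open>fixed_perms n k\<close> is nonempty: \<open>pmf_of_set {}\<close> is unspecified.
  For \<open>k \<le> n\<close> this fails exactly when \<open>k + 1 = n\<close>.\<close>

definition fixed_measure :: "nat \<Rightarrow> nat \<Rightarrow> (nat \<Rightarrow> nat) pmf" where
  "fixed_measure n k = pmf_of_set (fixed_perms n k)"

lemma finite_perms: "finite (perms n)"
  unfolding perms_def by (rule finite_permutations) simp

lemma perms_nonempty: "perms n \<noteq> {}"
  unfolding perms_def using permutes_id by blast

lemma fixed_measure_eq_conditional:
  assumes "fixed_perms n k \<noteq> {}"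
  shows "measure (fixed_measure n k) A
    = measure (perm_measure n) (A \<inter> fixed_perms n k) / measure (perm_measure n) (fixed_perms n k)"
proof -
  have sub: "fixed_perms n k \<subseteq> perms n"
    by (auto simp: fixed_perms_def)
  then have fin: "finite (fixed_perms n k)"
    using finite_perms finite_subset by blast
  have "perms n \<inter> (A \<inter> fixed_perms n k) = fixed_perms n k \<inter> A"
    and "perms n \<inter> fixed_perms n k = fixed_perms n k"
    using sub by auto
  then show ?thesis
    using assms fin perms_nonempty finite_perms
    by (simp add: fixed_measure_def perm_measure_def measure_pmf_of_set)
qed

end

theory Submission
  imports Defs
begin

text \<open>
  By invariance of the permutations with \<open>k\<close> fixed points under conjugation, the number of them that
  send a point \<open>i\<close> to \<open>u\<close> and another point \<open>j\<close> to \<open>v\<close> depends only on how \<open>u\<close> and \<open>v\<close>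
  coincide with \<open>i\<close> and \<open>j\<close>. Conjugation by the transposition of \<open>i\<close> and \<open>j\<close> reverses
  the order of the images of \<open>i\<close> and \<open>j\<close> whenever both images lie outside \<open>{i, j}\<close>, so only
  the permutations with an image in \<open>{i, j}\<close> bias that order. All their counts follow by
  double counting from the number of permutations exchanging \<open>i\<close> and \<open>j\<close>, which is a binomial
  multiple of a subfactorial. The subfactorial recursion turns this count into an elementary term plus
  a relative error of order \<open>m / m!\<close> for \<open>m = n - k\<close>.
\<close>

hide_const (open) Finite_Cartesian_Product.transpose

section \<open>Derangement numbers: recursions, a lower bound and a binomial identity\<close>

fun subfactorial :: "nat \<Rightarrow> real" where
  "subfactorial 0 = 1"
| "subfactorial (Suc m) = real (Suc m) * subfactorial m + (-1) ^ Suc m"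

text \<open>Dividing the recursion by the factorial makes it telescope. This form turns the
  denominator of \<open>excess\<close> into the alternating sum of the theorem.\<close>

lemma subfactorial_eq_sum: "subfactorial m = fact m * (\<Sum>l=0..m. (-1) ^ l / fact l)"
proof (induction m)
  case (Suc m)
  have "fact (Suc m) * ((-1) ^ Suc m / fact (Suc m)) = ((-1) ^ Suc m :: real)"
    by simp
  with Suc show ?case
    by (simp add: distrib_left del: fact_Suc power_Suc) (simp add: algebra_simps)
qed simp

text \<open>A recursion free of alternating signs, hence one along which lower bounds
  propagate.\<close>

lemma subfactorial_Suc_Suc:
  "subfactorial (Suc (Suc m)) = real (Suc m) * (subfactorial (Suc m) + subfactorial m)"
  by (simp add: algebra_simps)

text \<open>The factorial obeys the same two-term recursion, so the bound passes on from two
  consecutive indices. The shift by two skips the zero at index 1. The constant 3 is forced by the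
  base case 3, where 2 = 3! / 3.\<close>

lemma subfactorial_ge: "subfactorial (Suc (Suc m)) \<ge> fact (Suc (Suc m)) / 3"
proof (induction m rule: induct_nat_012)
  case (ge2 m)
  have "fact (Suc (Suc (Suc (Suc m)))) / 3
      = real (Suc (Suc (Suc m))) * (fact (Suc (Suc (Suc m))) / 3 + fact (Suc (Suc m)) / 3)"
    by (simp add: field_simps)
  also have "\<dots> \<le> real (Suc (Suc (Suc m))) *
      (subfactorial (Suc (Suc (Suc m))) + subfactorial (Suc (Suc m)))"
    by (intro mult_left_mono add_mono ge2) simp
  finally show ?case
    by (simp only: subfactorial_Suc_Suc)
qed simp_all

lemma subfactorial_lower_bound:
  assumes "m \<noteq> 1"
  shows "subfactorial m \<ge> fact m / 3"
proof (cases m)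
  case (Suc l)
  with assms obtain p where "m = Suc (Suc p)"
    by (cases l) auto
  then show ?thesis
    using subfactorial_ge by simp
qed simp

lemma subfactorial_pos:
  assumes "m \<noteq> 1"
  shows "subfactorial m > 0"
proof -
  have "(0::real) < fact m / 3"
    by simp
  also have "\<dots> \<le> subfactorial m"
    using assms by (rule subfactorial_lower_bound)
  finally show ?thesis .
qed

text \<open>Unfolding the recursion splits the sum: absorption turns one part into
  \<open>Suc n\<close> times the sum for \<open>n\<close>, and the signs form a full alternating
  binomial row, which vanishes. The identity later settles the count of permutations without fixed
  points.\<close>

lemma binomial_sum_subfactorial:
  "(\<Sum>m\<le>n. real (n choose m) * subfactorial m) = fact n"
proof (induction n)
  case (Suc n)
  have "(\<Sum>m\<le>Suc n. real (Suc n choose m) * subfactorial m)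
      = 1 + (\<Sum>m\<le>n. real (Suc m * (Suc n choose Suc m)) * subfactorial m
                      + (-1) ^ Suc m * real (Suc n choose Suc m))"
    by (simp add: sum.atMost_Suc_shift algebra_simps del: sum.atMost_Suc binomial_Suc_Suc)
  also have "\<dots> = (\<Sum>m\<le>n. real (Suc n * (n choose m)) * subfactorial m)
      + (\<Sum>m\<le>Suc n. (-1) ^ m * real (Suc n choose m))"
    unfolding Suc_times_binomial
    by (simp add: sum.atMost_Suc_shift sum.distrib sum_negf sum_subtractf mult.commute del: sum.atMost_Suc binomial_Suc_Suc)
  also have "(\<Sum>m\<le>Suc n. (-1) ^ m * real (Suc n choose m)) = 0"
    by (rule choose_alternating_sum) simp
  also have "(\<Sum>m\<le>n. real (Suc n * (n choose m)) * subfactorial m) = real (Suc n) * fact n"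
    by (simp only: Suc[symmetric] sum_distrib_left of_nat_mult mult.assoc)
  finally show ?case
    by simp
qed simp

section \<open>Counting permutations of a finite set by their number of fixed points\<close>

definition perms_with_fixed :: "'a set \<Rightarrow> nat \<Rightarrow> ('a \<Rightarrow> 'a) set" where
  "perms_with_fixed S k = {\<sigma>. \<sigma> permutes S \<and> card {x \<in> S. \<sigma> x = x} = k}"

lemma finite_perms_with_fixed [simp]: "finite S \<Longrightarrow> finite (perms_with_fixed S k)"
  by (rule finite_subset[OF _ finite_permutations[of S]]) (auto simp: perms_with_fixed_def)

lemma perms_with_fixed_permutes: "\<sigma> \<in> perms_with_fixed S k \<Longrightarrow> \<sigma> permutes S"
  by (simp add: perms_with_fixed_def)

lemma permutes_Diff_singleton_iff:
  assumes "x \<in> S"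
  shows "\<sigma> permutes (S - {x}) \<longleftrightarrow> \<sigma> permutes S \<and> \<sigma> x = x"
  using assms by (auto simp: permutes_def)

text \<open>Since \<open>permutes\<close> forces the identity outside the ground set, a fixed point
  can be deleted from that set while the function stays the same. Inductions on the set rest on
  this, hence the arbitrary ground sets.\<close>

lemma perms_with_fixed_point:
  assumes "finite S" "x \<in> S"
  shows "{\<sigma> \<in> perms_with_fixed S (Suc k). \<sigma> x = x} = perms_with_fixed (S - {x}) k"
proof -
  have "card {y \<in> S. \<sigma> y = y} = Suc (card {y \<in> S - {x}. \<sigma> y = y})" if "\<sigma> x = x" for \<sigma>
  proof -
    have "{y \<in> S. \<sigma> y = y} = insert x {y \<in> S - {x}. \<sigma> y = y}"
      using that assms by auto
    then show ?thesis
      using assms by simp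
  qed
  then show ?thesis
    using assms by (auto simp: perms_with_fixed_def permutes_Diff_singleton_iff)
qed

text \<open>Double counting of the pairs of a permutation and one of its fixed points.\<close>

lemma sum_card_fixed_point:
  assumes "finite S"
  shows "(\<Sum>x\<in>S. card {\<sigma> \<in> perms_with_fixed S k. \<sigma> x = x}) = k * card (perms_with_fixed S k)"
proof -
  have "(\<Sum>x\<in>S. card {\<sigma> \<in> perms_with_fixed S k. \<sigma> x = x})
      = (\<Sum>x\<in>S. \<Sum>\<sigma>\<in>perms_with_fixed S k. of_bool (\<sigma> x = x))"
    using assms by (simp add: Int_def)
  also have "\<dots> = (\<Sum>\<sigma>\<in>perms_with_fixed S k. \<Sum>x\<in>S. of_bool (\<sigma> x = x))"
    by (rule sum.swap)
  also have "\<dots> = (\<Sum>\<sigma>\<in>perms_with_fixed S k. k)"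
    using assms by (intro sum.cong) (auto simp: perms_with_fixed_def Int_def)
  finally show ?thesis
    by simp
qed

lemma sum_card_perms_with_fixed:
  assumes "finite S"
  shows "(\<Sum>k\<le>card S. card (perms_with_fixed S k)) = fact (card S)"
proof -
  have "{\<sigma>. \<sigma> permutes S} = (\<Union>k\<in>{..card S}. perms_with_fixed S k)"
    using assms by (auto simp: perms_with_fixed_def intro!: card_mono)
  moreover have "card (\<Union>k\<in>{..card S}. perms_with_fixed S k)
      = (\<Sum>k\<le>card S. card (perms_with_fixed S k))"
    using assms by (intro card_UN_disjoint ballI finite_perms_with_fixed) (auto simp: perms_with_fixed_def)
  ultimately show ?thesis
    using card_permutations[OF refl assms] by simp
qed

lemma card_perms_with_fixed:
  assumes "finite S" "k \<le> card S"
  shows "real (card (perms_with_fixed S k)) = real (card S choose k) * subfactorial (card S - k)"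
  using assms
proof (induction "card S" arbitrary: S k rule: less_induct)
  case less
  \<comment> \<open>For a positive number of fixed points, double counting reduces to sets with one
    element fewer; the absorption identity for binomials then lets the factor \<open>Suc l\<close>
    cancel.\<close>
  have fixed_pos: "real (card (perms_with_fixed S (Suc l)))
      = real (card S choose Suc l) * subfactorial (card S - Suc l)" if l: "Suc l \<le> card S" for l
  proof -
    obtain n where n: "card S = Suc n"
      using Suc_le_D[OF l] by blast
    have "real (Suc l) * real (card (perms_with_fixed S (Suc l)))
        = (\<Sum>x\<in>S. real (card (perms_with_fixed (S - {x}) l)))"
      unfolding of_nat_mult[symmetric] of_nat_sum[symmetric]
      by (subst sum_card_fixed_point[OF less.prems(1), symmetric])
        (simp add: perms_with_fixed_point less.prems(1))
    also have "\<dots> = (\<Sum>x\<in>S. real (n choose l) * subfactorial (n - l))"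
    proof (rule sum.cong[OF refl])
      fix x assume "x \<in> S"
      then have "card (S - {x}) = n"
        using less.prems(1) n by simp
      then show "real (card (perms_with_fixed (S - {x}) l)) = real (n choose l) * subfactorial (n - l)"
        using less.hyps[of "S - {x}" l] less.prems(1) l n by simp
    qed
    also have "\<dots> = real (Suc n * (n choose l)) * subfactorial (n - l)"
      by (simp only: n sum_constant of_nat_mult mult.assoc)
    also have "\<dots> = real (Suc l) * (real (card S choose Suc l) * subfactorial (card S - Suc l))"
      by (simp only: n Suc_times_binomial[symmetric] of_nat_mult mult.assoc diff_Suc_Suc)
    finally show ?thesis
      by (simp only: mult_left_cancel[OF of_nat_neq_0])
  qed
  show ?case
  proof (cases k)
    \<comment> \<open>The actual counts and the claimed ones both add up to
      \<open>fact (card S)\<close> and agree for every positive number of fixed points, so they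
      agree for none as well.\<close>
    case 0
    have "real (card (perms_with_fixed S 0)) + (\<Sum>l<card S. real (card (perms_with_fixed S (Suc l))))
        = fact (card S)"
      using arg_cong[OF sum_card_perms_with_fixed[OF less.prems(1)], of real]
      by (simp add: sum.atMost_shift)
    moreover have "subfactorial (card S)
        + (\<Sum>l<card S. real (card S choose Suc l) * subfactorial (card S - Suc l)) = fact (card S)"
    proof -
      have "(\<Sum>m\<le>card S. real (card S choose m) * subfactorial m)
          = (\<Sum>m\<le>card S. real (card S choose (card S - m)) * subfactorial (card S - m))"
        by (rule sum.reindex_bij_witness[of _ "\<lambda>m. card S - m" "\<lambda>m. card S - m"]) auto
      also have "\<dots> = (\<Sum>m\<le>card S. real (card S choose m) * subfactorial (card S - m))"
        by (intro sum.cong) (simp_all flip: binomial_symmetric)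
      finally show ?thesis
        using binomial_sum_subfactorial[of "card S"] by (simp add: sum.atMost_shift)
    qed
    moreover have "(\<Sum>l<card S. real (card (perms_with_fixed S (Suc l))))
        = (\<Sum>l<card S. real (card S choose Suc l) * subfactorial (card S - Suc l))"
      by (intro sum.cong fixed_pos) auto
    ultimately show ?thesis
      using 0 by simp
  next
    case (Suc l)
    then show ?thesis
      using fixed_pos less.prems by simp
  qed
qed


section \<open>Conjugation by transpositions, and joint counts of the images of two points\<close>

lemma bij_betw_conj_transpose:
  assumes "a \<in> S" "b \<in> S"
  shows "bij_betw (\<lambda>\<sigma>. transpose a b \<circ> \<sigma> \<circ> transpose a b) (perms_with_fixed S k) (perms_with_fixed S k)"
proof -
  let ?t = "transpose a b"
  have t: "?t permutes S"
    using assms by (rule permutes_swap_id)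
  have closed: "?t \<circ> \<sigma> \<circ> ?t \<in> perms_with_fixed S k" if "\<sigma> \<in> perms_with_fixed S k" for \<sigma>
  proof -
    have "{x \<in> S. (?t \<circ> \<sigma> \<circ> ?t) x = x} = ?t ` {x \<in> S. \<sigma> x = x}"
    proof (intro equalityI subsetI)
      fix x assume x: "x \<in> {x \<in> S. (?t \<circ> \<sigma> \<circ> ?t) x = x}"
      then have "?t (?t (\<sigma> (?t x))) = ?t x"
        by (simp only: mem_Collect_eq o_apply)
      then have "\<sigma> (?t x) = ?t x"
        by (simp only: transpose_involutory)
      with x have "?t x \<in> {x \<in> S. \<sigma> x = x}"
        using permutes_in_image[OF t] by simp
      then have "?t (?t x) \<in> ?t ` {x \<in> S. \<sigma> x = x}"
        by (rule imageI)
      then show "x \<in> ?t ` {x \<in> S. \<sigma> x = x}"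
        by simp
    next
      fix x assume "x \<in> ?t ` {x \<in> S. \<sigma> x = x}"
      then show "x \<in> {x \<in> S. (?t \<circ> \<sigma> \<circ> ?t) x = x}"
        using permutes_in_image[OF t] by auto
    qed
    then have "card {x \<in> S. (?t \<circ> \<sigma> \<circ> ?t) x = x} = card {x \<in> S. \<sigma> x = x}"
      using card_image[OF inj_on_subset[OF permutes_inj[OF t] subset_UNIV]] by simp
    moreover have "(?t \<circ> \<sigma> \<circ> ?t) permutes S"
      using t perms_with_fixed_permutes[OF that] by (simp add: permutes_compose)
    ultimately show ?thesis
      using that by (simp add: perms_with_fixed_def)
  qed
  have "?t \<circ> (?t \<circ> \<sigma> \<circ> ?t) \<circ> ?t = \<sigma>" for \<sigma> :: "'a \<Rightarrow> 'a"
    by (simp add: fun_eq_iff)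
  then show ?thesis
    using closed
    by (intro bij_betw_byWitness[where f' = "\<lambda>\<sigma>. ?t \<circ> \<sigma> \<circ> ?t"]) auto
qed

definition two_point_count :: "'a set \<Rightarrow> nat \<Rightarrow> 'a \<Rightarrow> 'a \<Rightarrow> 'a \<Rightarrow> 'a \<Rightarrow> nat" where
  "two_point_count S k x u y v = card {\<sigma> \<in> perms_with_fixed S k. \<sigma> x = u \<and> \<sigma> y = v}"

text \<open>Conjugation relabels arguments and values alike. Choosing transpositions that keep some
  of the four points shows that many of the counts are equal.\<close>

lemma two_point_count_transpose:
  fixes S :: "'a set"
  assumes "a \<in> S" "b \<in> S"
  shows "two_point_count S k (transpose a b x) (transpose a b u) (transpose a b y) (transpose a b v)
    = two_point_count S k x u y v"
proof -
  let ?t = "transpose a b"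
  have eq: "?t p = ?t q \<longleftrightarrow> p = q" for p q :: 'a
    by (rule inj_eq[OF permutes_inj[OF permutes_swap_id[OF assms]]])
  have "bij_betw (\<lambda>\<sigma>. ?t \<circ> \<sigma> \<circ> ?t) {\<sigma> \<in> perms_with_fixed S k. \<sigma> x = u \<and> \<sigma> y = v}
      {\<sigma> \<in> perms_with_fixed S k. \<sigma> (?t x) = ?t u \<and> \<sigma> (?t y) = ?t v}"
    using assms by (intro bij_betw_Collect[OF bij_betw_conj_transpose]) (auto simp: eq)
  from bij_betw_same_card[OF this] show ?thesis
    unfolding two_point_count_def by (rule sym)
qed


lemma sum_two_point_count:
  assumes "finite S" "y \<in> S"
  shows "(\<Sum>v\<in>S. two_point_count S k x u y v) = card {\<sigma> \<in> perms_with_fixed S k. \<sigma> x = u}"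
proof -
  have "\<sigma> y \<in> S" if "\<sigma> \<in> perms_with_fixed S k" for \<sigma>
    using permutes_in_image[OF perms_with_fixed_permutes[OF that]] assms by simp
  then have "{\<sigma> \<in> perms_with_fixed S k. \<sigma> x = u}
      = (\<Union>v\<in>S. {\<sigma> \<in> perms_with_fixed S k. \<sigma> x = u \<and> \<sigma> y = v})"
    by blast
  also have "card \<dots> = (\<Sum>v\<in>S. two_point_count S k x u y v)"
    unfolding two_point_count_def using assms by (intro card_UN_disjoint) auto
  finally show ?thesis
    by simp
qed

text \<open>Letting the two points coincide makes the invariance of pair counts available for a
  single point.\<close>

lemma two_point_count_same:
  "two_point_count S k x u x u = card {\<sigma> \<in> perms_with_fixed S k. \<sigma> x = u}"
  by (simp add: two_point_count_def)

lemma two_point_count_not_inj: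
  assumes "x \<noteq> y"
  shows "two_point_count S k x u y u = 0"
proof -
  have "{\<sigma> \<in> perms_with_fixed S k. \<sigma> x = u \<and> \<sigma> y = u} = {}"
    using assms permutes_inj[OF perms_with_fixed_permutes] by (auto dest: injD)
  then show ?thesis
    unfolding two_point_count_def by (metis card.empty)
qed

text \<open>By conjugation every point is fixed equally often, so the double count of fixed points
  has \<open>card S\<close> equal terms.\<close>

lemma card_fixing_point:
  assumes "finite S" "x \<in> S"
  shows "card S * card {\<sigma> \<in> perms_with_fixed S k. \<sigma> x = x} = k * card (perms_with_fixed S k)"
proof -
  have "card {\<sigma> \<in> perms_with_fixed S k. \<sigma> y = y} = card {\<sigma> \<in> perms_with_fixed S k. \<sigma> x = x}"
    if "y \<in> S" for y
    using two_point_count_transpose[OF assms(2) that, of k x x x x]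
    by (simp add: two_point_count_same)
  then show ?thesis
    using sum_card_fixed_point[OF assms(1), of k] by simp
qed

text \<open>Conjugating by a transposition that keeps \<open>x\<close> shows that all images of
  \<open>x\<close> other than \<open>x\<close> itself are equally frequent; the permutations are
  then sorted by the image of \<open>x\<close>.\<close>

lemma card_moving_point:
  assumes "finite S" "x \<in> S" "y \<in> S" "x \<noteq> y"
  shows "(card S - 1) * card {\<sigma> \<in> perms_with_fixed S k. \<sigma> x = y}
    + card {\<sigma> \<in> perms_with_fixed S k. \<sigma> x = x} = card (perms_with_fixed S k)"
proof -
  have eq: "card {\<sigma> \<in> perms_with_fixed S k. \<sigma> x = z} = card {\<sigma> \<in> perms_with_fixed S k. \<sigma> x = y}"
    if "z \<in> S - {x}" for z
  proof -
    have "transpose y z x = x"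
      using assms that by (intro transpose_apply_other) auto
    then show ?thesis
      using two_point_count_transpose[of y S z k x y x y] assms that
      by (simp add: two_point_count_same)
  qed
  have "\<sigma> x \<in> S" if "\<sigma> \<in> perms_with_fixed S k" for \<sigma>
    using permutes_in_image[OF perms_with_fixed_permutes[OF that]] assms by simp
  then have "perms_with_fixed S k = (\<Union>z\<in>S. {\<sigma> \<in> perms_with_fixed S k. \<sigma> x = z})"
    by blast
  then have "card (perms_with_fixed S k) = card (\<Union>z\<in>S. {\<sigma> \<in> perms_with_fixed S k. \<sigma> x = z})"
    by simp
  also have "\<dots> = (\<Sum>z\<in>S. card {\<sigma> \<in> perms_with_fixed S k. \<sigma> x = z})"
    using assms by (intro card_UN_disjoint) auto
  also have "\<dots> = card {\<sigma> \<in> perms_with_fixed S k. \<sigma> x = x}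
      + (\<Sum>z\<in>S - {x}. card {\<sigma> \<in> perms_with_fixed S k. \<sigma> x = z})"
    using assms by (intro sum.remove) auto
  also have "(\<Sum>z\<in>S - {x}. card {\<sigma> \<in> perms_with_fixed S k. \<sigma> x = z})
      = (card S - 1) * card {\<sigma> \<in> perms_with_fixed S k. \<sigma> x = y}"
  proof -
    have "(\<Sum>z\<in>S - {x}. card {\<sigma> \<in> perms_with_fixed S k. \<sigma> x = z})
        = (\<Sum>z\<in>S - {x}. card {\<sigma> \<in> perms_with_fixed S k. \<sigma> x = y})"
      by (rule sum.cong[OF refl eq])
    then show ?thesis
      using assms by simp
  qed
  finally show ?thesis
    by simp
qed

text \<open>\<open>card_fixing_point\<close> is used twice, once for \<open>x\<close> and once for
  \<open>y\<close> after \<open>x\<close> has been deleted from the ground set.\<close>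

lemma two_point_count_fixed_fixed:
  assumes "finite S" "x \<in> S" "y \<in> S" "x \<noteq> y"
  shows "card S * (card S - 1) * two_point_count S k x x y y
    = k * (k - 1) * card (perms_with_fixed S k)"
proof (cases k)
  case 0
  have "{\<sigma> \<in> perms_with_fixed S 0. \<sigma> x = x \<and> \<sigma> y = y} = {}"
    using assms by (auto simp: perms_with_fixed_def)
  then have "two_point_count S 0 x x y y = 0"
    unfolding two_point_count_def by (metis card.empty)
  with 0 show ?thesis
    by simp
next
  case (Suc l)
  have "{\<sigma> \<in> perms_with_fixed S k. \<sigma> x = x \<and> \<sigma> y = y}
      = {\<sigma> \<in> {\<sigma> \<in> perms_with_fixed S (Suc l). \<sigma> x = x}. \<sigma> y = y}"
    using Suc by auto
  also have "\<dots> = {\<sigma> \<in> perms_with_fixed (S - {x}) l. \<sigma> y = y}"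
    using assms by (simp add: perms_with_fixed_point)
  finally have "(card S - 1) * two_point_count S k x x y y = l * card (perms_with_fixed (S - {x}) l)"
    using card_fixing_point[of "S - {x}" y l] assms by (simp add: two_point_count_def)
  also have "card (perms_with_fixed (S - {x}) l) = card {\<sigma> \<in> perms_with_fixed S k. \<sigma> x = x}"
    using assms Suc by (simp add: perms_with_fixed_point)
  finally have "card S * (card S - 1) * two_point_count S k x x y y
      = l * (card S * card {\<sigma> \<in> perms_with_fixed S k. \<sigma> x = x})"
    by (simp only: mult.assoc mult.left_commute)
  also have "\<dots> = l * (k * card (perms_with_fixed S k))"
    using card_fixing_point[OF assms(1,2)] by simp
  finally show ?thesis
    using Suc by (simp add: algebra_simps)
qed

text \<open>Once \<open>x\<close> goes to \<open>u\<close>, injectivity leaves for \<open>y\<close>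
  the image \<open>w\<close> or one of the \<open>card S - 2\<close> points outside
  \<open>{x, y}\<close>, and the latter are equally frequent by conjugation. The choice
  \<open>u = x\<close> pairs with both points fixed, \<open>u = y\<close> with the exchange.\<close>

lemma two_point_count_remaining:
  assumes "finite S" "x \<in> S" "y \<in> S" "x \<noteq> y" "u \<in> {x, y}" "w \<in> {x, y}" "u \<noteq> w" "v \<in> S - {x, y}"
  shows "(card S - 2) * two_point_count S k x u y v + two_point_count S k x u y w
    = card {\<sigma> \<in> perms_with_fixed S k. \<sigma> x = u}"
proof -
  have eq: "two_point_count S k x u y z = two_point_count S k x u y v" if "z \<in> S - {x, y}" for z
  proof -
    have "transpose v z x = x" "transpose v z y = y" "transpose v z u = u"
      using that assms by (auto simp: transpose_def)
    then show ?thesis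
      using two_point_count_transpose[of v S z k x u y v] that assms by simp
  qed
  have S: "S = insert u (insert w (S - {x, y}))"
    using assms by auto
  have "card {\<sigma> \<in> perms_with_fixed S k. \<sigma> x = u}
      = (\<Sum>z\<in>insert u (insert w (S - {x, y})). two_point_count S k x u y z)"
    using sum_two_point_count[of S y k x u] assms(1,3) S by simp
  also have "\<dots> = two_point_count S k x u y w + (\<Sum>z\<in>S - {x, y}. two_point_count S k x u y z)"
    using assms two_point_count_not_inj[of x y S k u] by auto
  also have "(\<Sum>z\<in>S - {x, y}. two_point_count S k x u y z)
      = (card S - 2) * two_point_count S k x u y v"
  proof -
    have "(\<Sum>z\<in>S - {x, y}. two_point_count S k x u y z)
        = (\<Sum>z\<in>S - {x, y}. two_point_count S k x u y v)"
      by (rule sum.cong[OF refl eq])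
    then show ?thesis
      using assms by (simp add: card_Diff_subset numeral_2_eq_2)
  qed
  finally show ?thesis
    by simp
qed

text \<open>Composing with the transposition undoes the exchange and leaves a permutation of the
  other points. The exchanged points were not fixed, so no fixed point is lost.\<close>

lemma card_exchanging_points:
  assumes "finite S" "x \<in> S" "y \<in> S" "x \<noteq> y"
  shows "two_point_count S k x y y x = card (perms_with_fixed (S - {x, y}) k)"
proof -
  let ?t = "transpose x y"
  have t: "?t permutes S"
    using assms by (intro permutes_swap_id)
  have "bij_betw (\<lambda>\<sigma>. \<sigma> \<circ> ?t) {\<sigma> \<in> perms_with_fixed S k. \<sigma> x = y \<and> \<sigma> y = x}
      (perms_with_fixed (S - {x, y}) k)"
  proof (rule bij_betw_byWitness[where f' = "\<lambda>\<sigma>. \<sigma> \<circ> ?t"])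
    show "(\<lambda>\<sigma>. \<sigma> \<circ> ?t) ` {\<sigma> \<in> perms_with_fixed S k. \<sigma> x = y \<and> \<sigma> y = x}
        \<subseteq> perms_with_fixed (S - {x, y}) k"
    proof (rule image_subsetI)
      fix \<sigma> assume "\<sigma> \<in> {\<sigma> \<in> perms_with_fixed S k. \<sigma> x = y \<and> \<sigma> y = x}"
      then have \<sigma>: "\<sigma> \<in> perms_with_fixed S k" "\<sigma> x = y" "\<sigma> y = x"
        by auto
      have "(\<sigma> \<circ> ?t) permutes S"
        using t perms_with_fixed_permutes[OF \<sigma>(1)] by (rule permutes_compose)
      then have "(\<sigma> \<circ> ?t) permutes (S - {x, y})"
        using assms \<sigma> permutes_Diff_singleton_iff[of x S "\<sigma> \<circ> ?t"]
          permutes_Diff_singleton_iff[of y "S - {x}" "\<sigma> \<circ> ?t"]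
        by (simp add: Diff_insert2 [symmetric] insert_commute)
      moreover have "{z \<in> S - {x, y}. (\<sigma> \<circ> ?t) z = z} = {z \<in> S. \<sigma> z = z}"
      proof (rule set_eqI)
        fix z
        show "z \<in> {z \<in> S - {x, y}. (\<sigma> \<circ> ?t) z = z} \<longleftrightarrow> z \<in> {z \<in> S. \<sigma> z = z}"
          using \<sigma> assms by (cases "z = x \<or> z = y") auto
      qed
      ultimately show "\<sigma> \<circ> ?t \<in> perms_with_fixed (S - {x, y}) k"
        using \<sigma> by (simp add: perms_with_fixed_def)
    qed
    show "(\<lambda>\<sigma>. \<sigma> \<circ> ?t) ` perms_with_fixed (S - {x, y}) k
        \<subseteq> {\<sigma> \<in> perms_with_fixed S k. \<sigma> x = y \<and> \<sigma> y = x}"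
    proof (intro image_subsetI)
      fix \<sigma> assume \<sigma>: "\<sigma> \<in> perms_with_fixed (S - {x, y}) k"
      then have p: "\<sigma> permutes S - {x, y}"
        by (rule perms_with_fixed_permutes)
      then have "(\<sigma> \<circ> ?t) permutes S"
        by (intro permutes_compose[OF t] permutes_subset[OF p]) auto
      moreover have xy: "\<sigma> x = x" "\<sigma> y = y"
        using permutes_not_in[OF p] by auto
      moreover have "{z \<in> S. (\<sigma> \<circ> ?t) z = z} = {z \<in> S - {x, y}. \<sigma> z = z}"
      proof (rule set_eqI)
        fix z
        show "z \<in> {z \<in> S. (\<sigma> \<circ> ?t) z = z} \<longleftrightarrow> z \<in> {z \<in> S - {x, y}. \<sigma> z = z}"
          using xy assms by (cases "z = x \<or> z = y") auto
      qed
      ultimately show "\<sigma> \<circ> ?t \<in> {\<sigma> \<in> perms_with_fixed S k. \<sigma> x = y \<and> \<sigma> y = x}"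
        using \<sigma> by (simp add: perms_with_fixed_def)
    qed
  qed (auto simp: fun_eq_iff)
  then show ?thesis
    unfolding two_point_count_def by (rule bij_betw_same_card)
qed

lemma perms_with_fixed_empty:
  assumes "finite S" "card S < k"
  shows "perms_with_fixed S k = {}"
proof -
  have "card {x \<in> S. \<sigma> x = x} \<le> card S" for \<sigma>
    using assms by (intro card_mono) auto
  with assms(2) have "card {x \<in> S. \<sigma> x = x} \<noteq> k" for \<sigma>
    by (metis not_le)
  then show ?thesis
    by (simp add: perms_with_fixed_def)
qed

text \<open>The excluded case would leave exactly one point moved, which is impossible and matches
  the zero of \<open>subfactorial\<close> at 1.\<close>

lemma card_perms_with_fixed_pos:
  assumes "finite S" "k \<le> card S" "k + 1 \<noteq> card S"
  shows "card (perms_with_fixed S k) > 0"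
proof -
  have "subfactorial (card S - k) > 0"
    using assms by (intro subfactorial_pos) auto
  then have "real (card (perms_with_fixed S k)) > 0"
    using assms by (simp add: card_perms_with_fixed)
  then show ?thesis
    by simp
qed

lemma two_point_count_exchange:
  assumes "finite S" "x \<in> S" "y \<in> S" "x \<noteq> y" "k \<le> card S" "k + 1 \<noteq> card S"
  defines "m \<equiv> card S - k"
  shows "real (card S) * (real (card S) - 1) * real (two_point_count S k x y y x)
    = real (card (perms_with_fixed S k)) * (1 + (real m - 1) * (-1) ^ m / subfactorial m)"
proof (cases "k = card S")
  \<comment> \<open>Only the identity fixes every point, and it exchanges nothing; on the right
    \<open>m = 0\<close> gives the factor 1 - 1 = 0.\<close>
  case True
  have "card (S - {x, y}) < card S"
    using assms by (intro psubset_card_mono) auto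
  then have "two_point_count S k x y y x = 0"
    using assms True by (simp add: card_exchanging_points perms_with_fixed_empty)
  with True show ?thesis
    by (simp add: m_def)
next
  case False
  with assms have "k + 2 \<le> card S"
    by linarith
  then obtain p where p: "card S = k + 2 + p"
    using le_Suc_ex by blast
  define n where "n = k + p"
  have n: "card S = Suc (Suc n)" and kn: "k \<le> n" and p_def: "p = n - k"
    using p by (simp_all add: n_def)
  have m: "m = Suc (Suc p)"
    using n kn by (simp add: m_def p_def Suc_diff_le)
  have "card (S - {x, y}) = n"
    using assms n by (simp add: card_Diff_subset)
  then have E: "real (two_point_count S k x y y x) = real (n choose k) * subfactorial p"
    using assms kn by (simp add: card_exchanging_points card_perms_with_fixed p_def)
  have F: "real (card (perms_with_fixed S k)) = real (Suc (Suc n) choose k) * subfactorial m"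
    using card_perms_with_fixed[OF assms(1,5)] n by (simp add: m_def)
  \<comment> \<open>Absorption at \<open>Suc n\<close> and then at \<open>Suc (Suc n)\<close> trades
    the top index of the binomial for the factors \<open>m - 1\<close> and \<open>m\<close>.\<close>
  have "Suc (Suc n) * (Suc n * (n choose k)) = Suc (Suc n) * (Suc p * (Suc n choose k))"
    using binomial_absorb_comp[of "Suc n" k] kn by (simp add: p_def Suc_diff_le)
  also have "\<dots> = Suc p * (Suc (Suc n) * (Suc n choose k))"
    by (simp only: mult.left_commute)
  also have "Suc (Suc n) * (Suc n choose k) = m * (Suc (Suc n) choose k)"
    using binomial_absorb_comp[of "Suc (Suc n)" k] n by (simp add: m_def)
  finally have "Suc (Suc n) * (Suc n * (n choose k)) = Suc p * (m * (Suc (Suc n) choose k))" .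
  from arg_cong[OF this, of real] have binom: "real (Suc (Suc n)) * real (Suc n) * real (n choose k)
      = real m * real (Suc p) * real (Suc (Suc n) choose k)"
    by (simp only: of_nat_mult mult.assoc mult.left_commute)
  \<comment> \<open>Two unfoldings of the recursion. The sign terms that remain are the origin of
    \<open>excess\<close>.\<close>
  have D: "real m * real (Suc p) * subfactorial p = subfactorial m + (real m - 1) * (-1) ^ m"
    unfolding m by (simp add: algebra_simps)
  have D_pos: "subfactorial m > 0"
    using m by (intro subfactorial_pos) simp
  have "real (card S) * (real (card S) - 1) * real (two_point_count S k x y y x)
      = (real (Suc (Suc n)) * real (Suc n) * real (n choose k)) * subfactorial p"
    by (simp add: n E)
  also have "\<dots> = real (Suc (Suc n) choose k) * (real m * real (Suc p) * subfactorial p)"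
    unfolding binom by simp
  also have "\<dots> = real (card (perms_with_fixed S k)) * (1 + (real m - 1) * (-1) ^ m / subfactorial m)"
    unfolding D F using D_pos by (simp add: field_simps)
  finally show ?thesis .
qed

section \<open>The order of the images of two points\<close>

lemma card_Collect_member_eq_sum:
  assumes "finite F" "finite B"
  shows "card {x \<in> F. P x \<and> f x \<in> B} = (\<Sum>b\<in>B. card {x \<in> F. P x \<and> f x = b})"
proof -
  have "{x \<in> F. P x \<and> f x \<in> B} = (\<Union>b\<in>B. {x \<in> F. P x \<and> f x = b})"
    by auto
  also have "card \<dots> = (\<Sum>b\<in>B. card {x \<in> F. P x \<and> f x = b})"
    using assms by (intro card_UN_disjoint) auto
  finally show ?thesis .
qed

text \<open>The count is averaged with its copy under conjugation by the transposition of
  \<open>i\<close> and \<open>j\<close>. For most permutations the two order conditions exclude each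
  other and together contribute 1; the remaining terms record the exceptions.\<close>

lemma card_less_images:
  fixes S :: "nat set" and k :: nat
  assumes "finite S" "i \<in> S" "j \<in> S" "i < j"
  defines "F \<equiv> perms_with_fixed S k" and "B \<equiv> {i<..<j}"
  shows "2 * int (card {\<sigma> \<in> F. \<sigma> i < \<sigma> j})
    = int (card F) + int (two_point_count S k i i j j) - int (two_point_count S k i j j i)
      + 2 * (\<Sum>b\<in>B. int (two_point_count S k i i j b) - int (two_point_count S k i j j b))"
proof -
  let ?t = "transpose i j"
  have fin: "finite F" "finite B"
    using assms by simp_all
  have t: "?t i = j" "?t j = i" "?t b = b" if "b \<in> B" for b
    using that by (auto simp: B_def transpose_def)
  \<comment> \<open>The conjugate sends \<open>i\<close> to \<open>?t (\<sigma> j)\<close> and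
    \<open>j\<close> to \<open>?t (\<sigma> i)\<close>.\<close>
  have conj: "card {\<sigma> \<in> F. \<sigma> i < \<sigma> j} = card {\<sigma> \<in> F. ?t (\<sigma> j) < ?t (\<sigma> i)}"
  proof (rule sym, rule bij_betw_same_card)
    show "bij_betw (\<lambda>\<sigma>. ?t \<circ> \<sigma> \<circ> ?t) {\<sigma> \<in> F. ?t (\<sigma> j) < ?t (\<sigma> i)} {\<sigma> \<in> F. \<sigma> i < \<sigma> j}"
      unfolding F_def using assms by (intro bij_betw_Collect[OF bij_betw_conj_transpose]) auto
  qed
  \<comment> \<open>Conjugation exchanges the roles of \<open>i\<close> and \<open>j\<close>, so of
    the four families with one image in \<open>B\<close> only two differ.\<close>
  have swap: "two_point_count S k i b j j = two_point_count S k i i j b"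
    "two_point_count S k i b j i = two_point_count S k i j j b" if "b \<in> B" for b
    using two_point_count_transpose[OF assms(2,3), of k i b j j]
      two_point_count_transpose[OF assms(2,3), of k i b j i] t[OF that]
    by (simp_all add: two_point_count_def conj_commute)
  have card_sum: "int (card {\<sigma> \<in> F. P \<sigma>}) = (\<Sum>\<sigma>\<in>F. of_bool (P \<sigma>))" for P
    using fin by (simp add: Int_def)
  have count: "int (card {\<sigma> \<in> F. \<sigma> x = u \<and> \<sigma> y \<in> B}) = (\<Sum>b\<in>B. int (two_point_count S k x u y b))"
    for x u y
    using card_Collect_member_eq_sum[OF fin, of "\<lambda>\<sigma>. \<sigma> x = u" "\<lambda>\<sigma>. \<sigma> y"]
    by (simp add: two_point_count_def F_def)
  have count': "int (card {\<sigma> \<in> F. \<sigma> y = v \<and> \<sigma> x \<in> B}) = (\<Sum>b\<in>B. int (two_point_count S k x b y v))"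
    for x y v
    using card_Collect_member_eq_sum[OF fin, of "\<lambda>\<sigma>. \<sigma> y = v" "\<lambda>\<sigma>. \<sigma> x"]
    by (simp add: two_point_count_def F_def conj_commute)
  \<comment> \<open>The transposition keeps the order of two values unless one is \<open>i\<close>
    or \<open>j\<close> and the other is its partner or lies strictly between. The two indicators
    then sum to 2 or to 0 instead of 1, which the signed terms correct.\<close>
  have pair: "of_bool (x < y) + of_bool (?t y < ?t x)
      = 1 + of_bool (x = i \<and> y = j) - of_bool (x = j \<and> y = i)
        + of_bool (x = i \<and> y \<in> B) + of_bool (y = j \<and> x \<in> B)
        - of_bool (x = j \<and> y \<in> B) - (of_bool (y = i \<and> x \<in> B) :: int)" if "x \<noteq> y" for x y
  proof -
    consider "x = i" | "x = j" | "x \<noteq> i" "x \<noteq> j"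
      by blast
    then show ?thesis
    proof cases
      assume "x = i"
      then show ?thesis
        using that \<open>i < j\<close> by (cases "y = j"; cases "y < j"; cases "i < y") (simp_all add: B_def)
    next
      assume "x = j"
      then show ?thesis
        using that \<open>i < j\<close> by (cases "y = i"; cases "y < j"; cases "i < y") (simp_all add: B_def)
    next
      assume "x \<noteq> i" "x \<noteq> j"
      then show ?thesis
        using that \<open>i < j\<close>
        by (cases "y = i"; cases "y = j"; cases "x < j"; cases "i < x"; cases "x < y") (simp_all add: B_def)
    qed
  qed
  have "2 * int (card {\<sigma> \<in> F. \<sigma> i < \<sigma> j})
      = (\<Sum>\<sigma>\<in>F. of_bool (\<sigma> i < \<sigma> j) + of_bool (?t (\<sigma> j) < ?t (\<sigma> i)))"
    using conj by (simp add: sum.distrib flip: card_sum)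
  also have "\<dots> = (\<Sum>\<sigma>\<in>F. 1 + of_bool (\<sigma> i = i \<and> \<sigma> j = j) - of_bool (\<sigma> i = j \<and> \<sigma> j = i)
        + of_bool (\<sigma> i = i \<and> \<sigma> j \<in> B) + of_bool (\<sigma> j = j \<and> \<sigma> i \<in> B)
        - of_bool (\<sigma> i = j \<and> \<sigma> j \<in> B) - of_bool (\<sigma> j = i \<and> \<sigma> i \<in> B))"
  proof (intro sum.cong refl pair)
    fix \<sigma> assume "\<sigma> \<in> F"
    then show "\<sigma> i \<noteq> \<sigma> j"
      using \<open>i < j\<close> permutes_inj[of \<sigma> S] by (auto simp: F_def perms_with_fixed_def dest: injD)
  qed
  also have "\<dots> = int (card F) + int (card {\<sigma> \<in> F. \<sigma> i = i \<and> \<sigma> j = j})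
      - int (card {\<sigma> \<in> F. \<sigma> i = j \<and> \<sigma> j = i})
      + int (card {\<sigma> \<in> F. \<sigma> i = i \<and> \<sigma> j \<in> B}) + int (card {\<sigma> \<in> F. \<sigma> j = j \<and> \<sigma> i \<in> B})
      - int (card {\<sigma> \<in> F. \<sigma> i = j \<and> \<sigma> j \<in> B}) - int (card {\<sigma> \<in> F. \<sigma> j = i \<and> \<sigma> i \<in> B})"
    unfolding card_sum by (simp add: sum.distrib sum_subtractf)
  also have "int (card {\<sigma> \<in> F. \<sigma> i = i \<and> \<sigma> j \<in> B}) = (\<Sum>b\<in>B. int (two_point_count S k i i j b))"
    by (rule count)
  also have "int (card {\<sigma> \<in> F. \<sigma> i = j \<and> \<sigma> j \<in> B}) = (\<Sum>b\<in>B. int (two_point_count S k i j j b))"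
    by (rule count)
  also have "int (card {\<sigma> \<in> F. \<sigma> j = j \<and> \<sigma> i \<in> B}) = (\<Sum>b\<in>B. int (two_point_count S k i b j j))"
    by (rule count')
  also have "\<dots> = (\<Sum>b\<in>B. int (two_point_count S k i i j b))"
    using swap by (intro sum.cong) auto
  also have "int (card {\<sigma> \<in> F. \<sigma> j = i \<and> \<sigma> i \<in> B}) = (\<Sum>b\<in>B. int (two_point_count S k i b j i))"
    by (rule count')
  also have "\<dots> = (\<Sum>b\<in>B. int (two_point_count S k i j j b))"
    using swap by (intro sum.cong) auto
  finally show ?thesis
    by (simp add: two_point_count_def F_def sum_subtractf)
qed

text \<open>
  The relative deviation of the number of permutations exchanging two given points from the
  \<open>n (n - 1)\<close>-th part of the whole; see \<open>two_point_count_exchange\<close>.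
\<close>

definition excess :: "nat \<Rightarrow> real" where
  "excess m = (real m - 1) * (-1) ^ m / subfactorial m"

text \<open>All counts in \<open>card_less_images\<close> follow from the fixed pair and the
  exchanged pair, and only the latter involves \<open>excess\<close>. Hence \<open>excess\<close>
  enters linearly and can be split off as an error term.\<close>

lemma proportion_less_images:
  fixes n k i j :: nat
  assumes n: "3 \<le> n" and k: "k \<le> n" "k + 1 \<noteq> n" and ij: "1 \<le> i" "i < j" "j \<le> n"
  defines "F \<equiv> perms_with_fixed {1..n} k" and "d \<equiv> real j - real i"
  shows "real (card {\<sigma> \<in> F. \<sigma> i < \<sigma> j}) / real (card F)
    = 1 / 2 + 1 / (2 * real n * (real n - 1) * (real n - 2))
        * ((2 * (real k - 1) * d + (real k)\<^sup>2 - 3 * real k + 1) * real n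
           - 2 * ((real k)\<^sup>2 - real k - 1) * d)
      + excess (n - k) / (real n * (real n - 1)) * ((d - 1) / (real n - 2) - 1 / 2)"
proof -
  let ?S = "{1..n}"
  define f where "f = real (card F)"
  define A where "A = real (two_point_count ?S k i i j j)"
  define E where "E = real (two_point_count ?S k i j j i)"
  define N where "N = real n"
  define K where "K = real k"
  define \<epsilon> where "\<epsilon> = excess (n - k)"
  have S: "finite ?S" "i \<in> ?S" "j \<in> ?S" "i \<noteq> j" "card ?S = n"
    using ij by auto
  have N: "N \<ge> 3"
    using n by (simp add: N_def)
  have f: "f > 0"
    using card_perms_with_fixed_pos[of ?S k] k by (simp add: f_def F_def)
  have N': "real (n - 1) = N - 1" "real (n - 2) = N - 2"
    using n by (simp_all add: N_def)
  have "N * (N - 1) * A = K * real (k - 1) * f"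
    using arg_cong[OF two_point_count_fixed_fixed[OF S(1-4), of k], of real]
    unfolding S(5) A_def K_def f_def F_def of_nat_mult N' by (simp add: N_def)
  moreover have "K * real (k - 1) = K * (K - 1)"
    by (cases k) (auto simp: K_def)
  ultimately have "N * (N - 1) * A = K * (K - 1) * f"
    by simp
  then have A: "A = f * (K * (K - 1) / (N * (N - 1)))"
    using N by (simp add: field_simps)
  have E: "E = f * ((1 + \<epsilon>) / (N * (N - 1)))"
    using two_point_count_exchange[OF S(1-4), of k] k N
    by (simp add: E_def f_def F_def \<epsilon>_def excess_def N_def field_simps)
  define X where "X = real (card {\<sigma> \<in> F. \<sigma> i = i})"
  have "N * X = K * f"
    using arg_cong[OF card_fixing_point[OF S(1,2), of k], of real]
    unfolding S(5) X_def K_def f_def F_def N_def by (simp only: of_nat_mult)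
  then have X: "X = f * (K / N)"
    using N by (simp add: field_simps)
  define Y where "Y = real (card {\<sigma> \<in> F. \<sigma> i = j})"
  have "(N - 1) * Y + X = f"
    using arg_cong[OF card_moving_point[OF S(1-4), of k], of real]
    unfolding S(5) X_def Y_def f_def F_def by (simp only: of_nat_mult of_nat_add N')
  then have Y: "Y = (f - X) / (N - 1)"
    using N by (simp add: field_simps)
  \<comment> \<open>The value is independent of \<open>b\<close>, so the sum over the points between
    \<open>i\<close> and \<open>j\<close> is just \<open>d - 1\<close> times it.\<close>
  have BG: "real (two_point_count ?S k i i j b) - real (two_point_count ?S k i j j b)
      = f * ((K * (N - K) - (N - K - 1 - \<epsilon>)) / (N * (N - 1) * (N - 2)))" if "b \<in> {i<..<j}" for b
  proof -
    have b: "b \<in> ?S - {i, j}"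
      using that ij by auto
    have "(N - 2) * real (two_point_count ?S k i i j b) + A = X"
      using arg_cong[OF two_point_count_remaining[OF S(1-4), of i j b k], of real] b S(4)
      unfolding S(5) X_def A_def F_def of_nat_mult of_nat_add N' by simp
    then have "real (two_point_count ?S k i i j b) = (X - A) / (N - 2)"
      using N by (simp add: field_simps)
    moreover have "(N - 2) * real (two_point_count ?S k i j j b) + E = Y"
      using arg_cong[OF two_point_count_remaining[OF S(1-4), of j i b k], of real] b S(4)
      unfolding S(5) Y_def E_def F_def of_nat_mult of_nat_add N' by simp
    then have "real (two_point_count ?S k i j j b) = (Y - E) / (N - 2)"
      using N by (simp add: field_simps)
    ultimately show ?thesis
      unfolding A E X Y using N by (simp add: divide_simps) (simp add: algebra_simps)
  qed
  have d: "real (card {i<..<j}) = d - 1"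
    using ij by (simp add: d_def of_nat_diff)
  have "2 * real (card {\<sigma> \<in> F. \<sigma> i < \<sigma> j})
      = f + A - E + 2 * (\<Sum>b\<in>{i<..<j}. real (two_point_count ?S k i i j b) - real (two_point_count ?S k i j j b))"
    using arg_cong[OF card_less_images[OF S(1-3) ij(2), of k], of real_of_int]
    unfolding f_def A_def E_def F_def by simp
  also have "\<dots> = f + A - E + 2 * ((d - 1) * (f * ((K * (N - K) - (N - K - 1 - \<epsilon>)) / (N * (N - 1) * (N - 2)))))"
    using BG d by simp
  also have "\<dots> = f * (1 + K * (K - 1) / (N * (N - 1)) - (1 + \<epsilon>) / (N * (N - 1))
      + 2 * (d - 1) * (K * (N - K) - (N - K - 1 - \<epsilon>)) / (N * (N - 1) * (N - 2)))"
    unfolding A E by (simp add: algebra_simps)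
  finally have "real (card {\<sigma> \<in> F. \<sigma> i < \<sigma> j}) / f
      = (1 + K * (K - 1) / (N * (N - 1)) - (1 + \<epsilon>) / (N * (N - 1))
         + 2 * (d - 1) * (K * (N - K) - (N - K - 1 - \<epsilon>)) / (N * (N - 1) * (N - 2))) / 2"
    using f by (simp add: field_simps)
  \<comment> \<open>Regrouping by \<epsilon>, which enters through the exchange itself and through
    the \<open>d - 1\<close> points in between.\<close>
  also have "\<dots> = 1 / 2 + 1 / (2 * N * (N - 1) * (N - 2))
        * ((2 * (K - 1) * d + K\<^sup>2 - 3 * K + 1) * N - 2 * (K\<^sup>2 - K - 1) * d)
      + \<epsilon> / (N * (N - 1)) * ((d - 1) / (N - 2) - 1 / 2)"
    using N by (simp add: divide_simps) (simp add: algebra_simps power2_eq_square)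
  finally show ?thesis
    by (simp add: f_def N_def K_def \<epsilon>_def)
qed


section \<open>From counts to probabilities and to the expected number of inversions\<close>

lemma fixed_perms_eq: "fixed_perms n k = perms_with_fixed {1..n} k"
  by (auto simp: fixed_perms_def perms_def perms_with_fixed_def)

lemma bij_betw_inv_perms_with_fixed: "bij_betw inv (perms_with_fixed S k) (perms_with_fixed S k)"
proof -
  have "inv \<sigma> \<in> perms_with_fixed S k \<and> inv (inv \<sigma>) = \<sigma>" if "\<sigma> \<in> perms_with_fixed S k" for \<sigma>
  proof -
    have p: "\<sigma> permutes S"
      using that by (rule perms_with_fixed_permutes)
    have "inv \<sigma> x = x \<longleftrightarrow> \<sigma> x = x" for x
      using permutes_inv_eq[OF p, of x x] by simp
    then show ?thesis
      using that p by (simp add: perms_with_fixed_def permutes_inv permutes_inv_inv)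
  qed
  then show ?thesis
    by (intro bij_betw_byWitness[where f' = inv]) auto
qed

text \<open>A permutation and its inverse have the same fixed points, so positions and images are
  equally distributed and the event may be counted by images.\<close>

lemma prob_inv_less:
  fixes n k i j :: nat
  assumes "k \<le> n" "k + 1 \<noteq> n"
  shows "measure_pmf.prob (fixed_measure n k) {\<sigma>. inv \<sigma> i < inv \<sigma> j}
    = real (card {\<sigma> \<in> perms_with_fixed {1..n} k. \<sigma> i < \<sigma> j}) / real (card (perms_with_fixed {1..n} k))"
proof -
  let ?F = "perms_with_fixed {1..n} k"
  have "card ?F > 0"
    using assms by (intro card_perms_with_fixed_pos) auto
  then have ne: "?F \<noteq> {}"
    by auto
  have "bij_betw inv {\<sigma> \<in> ?F. inv \<sigma> i < inv \<sigma> j} {\<sigma> \<in> ?F. \<sigma> i < \<sigma> j}"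
    by (rule bij_betw_Collect[OF bij_betw_inv_perms_with_fixed]) simp
  then have "card {\<sigma> \<in> ?F. inv \<sigma> i < inv \<sigma> j} = card {\<sigma> \<in> ?F. \<sigma> i < \<sigma> j}"
    by (rule bij_betw_same_card)
  then show ?thesis
    using ne by (simp add: fixed_measure_def fixed_perms_eq measure_pmf_of_set Int_def)
qed

text \<open>The factors are the number of pairs and the sum of their differences, the latter being
  \<open>(n + 1) choose 3\<close>.\<close>

lemma sum_pairs_affine:
  fixes a b :: real
  shows "(\<Sum>j\<in>{1..n}. \<Sum>i\<in>{1..<j}. a + b * (real j - real i))
    = a * (real n * (real n - 1) / 2) + b * (real n * ((real n)\<^sup>2 - 1) / 6)"
proof (induction n)
  case (Suc n)
  \<comment> \<open>The constant \<open>c\<close> is kept apart from the upper limit so that the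
    induction on \<open>m\<close> does not change it.\<close>
  have inner: "(\<Sum>i\<in>{1..<Suc m}. a + b * (c - real i)) = real m * (a + b * c) - b * (real m * (real m + 1) / 2)"
    for c m
    by (induction m) (auto simp: field_simps)
  have "(\<Sum>j\<in>{1..Suc n}. \<Sum>i\<in>{1..<j}. a + b * (real j - real i))
      = (\<Sum>j\<in>{1..n}. \<Sum>i\<in>{1..<j}. a + b * (real j - real i))
        + (\<Sum>i\<in>{1..<Suc n}. a + b * (real (Suc n) - real i))"
    by simp
  also have "\<dots> = a * (real (Suc n) * (real (Suc n) - 1) / 2)
      + b * (real (Suc n) * ((real (Suc n))\<^sup>2 - 1) / 6)"
    unfolding Suc inner by (simp add: power2_eq_square field_simps)
  finally show ?case .
qed simp

text \<open>By linearity the expectation is the sum over pairs of the probability of an inversion,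
  which is affine in the difference of the two indices.\<close>

lemma expectation_inversions:
  fixes n k :: nat
  assumes n: "3 \<le> n" and k: "k \<le> n" "k + 1 \<noteq> n"
  shows "measure_pmf.expectation (fixed_measure n k) (\<lambda>\<sigma>. real (inversions n \<sigma>))
    = real n * (real n - 1) / 4 - (real k - 1) / 6 * real n - ((real k)\<^sup>2 - real k - 1) / 12
      + excess (n - k) / 12"
proof -
  let ?F = "perms_with_fixed {1..n} k"
  define N where "N = real n"
  define K where "K = real k"
  define \<epsilon> where "\<epsilon> = excess (n - k)"
  \<comment> \<open>\<alpha> and \<beta> are the coefficients of
    \<open>proportion_less_images\<close> read as an affine function of \<open>j - i\<close>; the 1
    in its \<open>d - 1\<close> is absorbed into \<alpha>.\<close>
  define \<alpha> where "\<alpha> = 1 / 2 + (K\<^sup>2 - 3 * K + 1) / (2 * (N - 1) * (N - 2))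
    - \<epsilon> / (N * (N - 1)) * (1 / (N - 2) + 1 / 2)"
  define \<beta> where "\<beta> = ((K - 1) * N - (K\<^sup>2 - K - 1) + \<epsilon>) / (N * (N - 1) * (N - 2))"
  have N: "N \<ge> 3"
    using n by (simp add: N_def)
  have pos: "card ?F > 0"
    using k by (intro card_perms_with_fixed_pos) auto
  have ne: "?F \<noteq> {}"
    using pos by auto
  have inversion: "real (card {\<sigma> \<in> ?F. \<sigma> j < \<sigma> i}) / real (card ?F)
      = (1 - \<alpha>) + (- \<beta>) * (real j - real i)" if ij: "j \<in> {1..n}" "i \<in> {1..<j}" for i j
  proof -
    have "?F = {\<sigma> \<in> ?F. \<sigma> i < \<sigma> j} \<union> {\<sigma> \<in> ?F. \<sigma> j < \<sigma> i}"
    proof -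
      have "\<sigma> i \<noteq> \<sigma> j" if "\<sigma> \<in> ?F" for \<sigma>
        using ij permutes_inj[OF perms_with_fixed_permutes[OF that]] by (auto dest: injD)
      then show ?thesis
        by (auto simp: neq_iff)
    qed
    then have "card ?F = card ({\<sigma> \<in> ?F. \<sigma> i < \<sigma> j} \<union> {\<sigma> \<in> ?F. \<sigma> j < \<sigma> i})"
      by (rule arg_cong)
    also have "\<dots> = card {\<sigma> \<in> ?F. \<sigma> i < \<sigma> j} + card {\<sigma> \<in> ?F. \<sigma> j < \<sigma> i}"
      by (rule card_Un_disjoint) auto
    finally have "real (card {\<sigma> \<in> ?F. \<sigma> j < \<sigma> i}) = real (card ?F) - real (card {\<sigma> \<in> ?F. \<sigma> i < \<sigma> j})"
      by linarith
    then have "real (card {\<sigma> \<in> ?F. \<sigma> j < \<sigma> i}) / real (card ?F)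
        = 1 - real (card {\<sigma> \<in> ?F. \<sigma> i < \<sigma> j}) / real (card ?F)"
      using ne pos by (simp only: diff_divide_distrib) simp
    also have "real (card {\<sigma> \<in> ?F. \<sigma> i < \<sigma> j}) / real (card ?F) = \<alpha> + \<beta> * (real j - real i)"
    proof -
      have "1 \<le> i" "i < j" "j \<le> n"
        using ij by auto
      then show ?thesis
        using N
        by (simp only: proportion_less_images[OF n k] \<alpha>_def \<beta>_def
            N_def[symmetric] K_def[symmetric] \<epsilon>_def[symmetric])
          (simp add: divide_simps, simp add: algebra_simps power2_eq_square)
    qed
    finally show ?thesis
      by simp
  qed
  have "measure_pmf.expectation (fixed_measure n k) (\<lambda>\<sigma>. real (inversions n \<sigma>))
      = (\<Sum>\<sigma>\<in>?F. \<Sum>j\<in>{1..n}. \<Sum>i\<in>{1..<j}. of_bool (\<sigma> j < \<sigma> i)) / real (card ?F)"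
    using ne by (simp add: fixed_measure_def fixed_perms_eq integral_pmf_of_set inversions_def)
  also have "(\<Sum>\<sigma>\<in>?F. \<Sum>j\<in>{1..n}. \<Sum>i\<in>{1..<j}. of_bool (\<sigma> j < \<sigma> i) :: real)
      = (\<Sum>j\<in>{1..n}. \<Sum>i\<in>{1..<j}. \<Sum>\<sigma>\<in>?F. of_bool (\<sigma> j < \<sigma> i))"
    by (subst sum.swap) (intro sum.cong refl sum.swap)
  also have "\<dots> = (\<Sum>j\<in>{1..n}. \<Sum>i\<in>{1..<j}. real (card {\<sigma> \<in> ?F. \<sigma> j < \<sigma> i}))"
    by (simp add: Int_def)
  also have "\<dots> / real (card ?F)
      = (\<Sum>j\<in>{1..n}. \<Sum>i\<in>{1..<j}. real (card {\<sigma> \<in> ?F. \<sigma> j < \<sigma> i}) / real (card ?F))"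
    by (simp only: sum_divide_distrib)
  also have "\<dots> = (\<Sum>j\<in>{1..n}. \<Sum>i\<in>{1..<j}. (1 - \<alpha>) + (- \<beta>) * (real j - real i))"
    by (intro sum.cong refl inversion)
  also have "\<dots> = (1 - \<alpha>) * (N * (N - 1) / 2) + (- \<beta>) * (N * (N\<^sup>2 - 1) / 6)"
    unfolding N_def by (rule sum_pairs_affine)
  \<comment> \<open>The coefficient of \<epsilon> is N / (4 (N - 2)) - (N + 1) / (6 (N - 2)), which
    collapses to 1 / 12.\<close>
  also have "\<dots> = N * (N - 1) / 4 - (K - 1) / 6 * N - (K\<^sup>2 - K - 1) / 12 + \<epsilon> / 12"
    unfolding \<alpha>_def \<beta>_def using N
    by (simp add: divide_simps) (simp add: algebra_simps power2_eq_square)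
  finally show ?thesis
    by (simp add: N_def K_def \<epsilon>_def)
qed

section \<open>Error bounds and the final statement\<close>

lemma abs_excess_le:
  assumes "m \<noteq> 1"
  shows "\<bar>excess m\<bar> \<le> 3 * \<bar>real m - 1\<bar> / fact m"
proof -
  have "\<bar>excess m\<bar> = \<bar>real m - 1\<bar> / subfactorial m"
    using subfactorial_pos[OF assms] by (simp add: excess_def abs_mult)
  also have "\<dots> \<le> \<bar>real m - 1\<bar> / (fact m / 3)"
    using subfactorial_lower_bound[OF assms] subfactorial_pos[OF assms]
    by (intro divide_left_mono mult_pos_pos) auto
  finally show ?thesis
    by (simp add: mult.commute)
qed

theorem theorem2:
  "(\<forall>n k :: nat. 3 \<le> n \<and> 1 \<le> k \<and> k \<le> n \<and> k + 1 \<noteq> n \<longrightarrow>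
      measure_pmf.expectation (fixed_measure n k) (\<lambda>\<sigma>. real (inversions n \<sigma>))
        = real n * (real n - 1) / 4 - (real k - 1) / 6 * real n
          - ((real k)\<^sup>2 - real k - 1) / 12
          + ((-1) ^ (n - k) / fact (n - k)) / (\<Sum>l=0..n - k. (-1) ^ l / fact l)
            * ((real n - real k - 1) / 12))
   \<and>
   (\<exists>C :: real. \<forall>n k :: nat. 3 \<le> n \<and> 1 \<le> k \<and> k \<le> n \<and> k + 1 \<noteq> n \<longrightarrow>
      \<bar>measure_pmf.expectation (fixed_measure n k) (\<lambda>\<sigma>. real (inversions n \<sigma>))
        - (real n * (real n - 1) / 4 - (real k - 1) / 6 * real n
           - ((real k)\<^sup>2 - real k - 1) / 12)\<bar>
        \<le> C * (1 / fact (n - k - 1)))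
   \<and>
   (\<exists>C :: real. \<forall>n k i j :: nat. 3 \<le> n \<and> 1 \<le> k \<and> k \<le> n \<and> k + 1 \<noteq> n \<and>
        1 \<le> i \<and> i < j \<and> j \<le> n \<longrightarrow>
      \<bar>measure_pmf.prob (fixed_measure n k) {\<sigma>. inv \<sigma> i < inv \<sigma> j}
        - (1 / 2 + 1 / (2 * real n * (real n - 1) * (real n - 2))
            * ((2 * (real k - 1) * (real j - real i) + (real k)\<^sup>2 - 3 * real k + 1) * real n
               - 2 * ((real k)\<^sup>2 - real k - 1) * (real j - real i)))\<bar>
        \<le> C * (1 / fact (n - k)))"
proof (intro conjI)
  show "\<forall>n k :: nat. 3 \<le> n \<and> 1 \<le> k \<and> k \<le> n \<and> k + 1 \<noteq> n \<longrightarrow>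
      measure_pmf.expectation (fixed_measure n k) (\<lambda>\<sigma>. real (inversions n \<sigma>))
        = real n * (real n - 1) / 4 - (real k - 1) / 6 * real n
          - ((real k)\<^sup>2 - real k - 1) / 12
          + ((-1) ^ (n - k) / fact (n - k)) / (\<Sum>l=0..n - k. (-1) ^ l / fact l)
            * ((real n - real k - 1) / 12)"
  proof (intro allI impI, elim conjE)
    fix n k :: nat
    assume nk: "3 \<le> n" "k \<le> n" "k + 1 \<noteq> n"
    have "excess (n - k) = ((-1) ^ (n - k) / fact (n - k)) / (\<Sum>l=0..n - k. (-1) ^ l / fact l)
        * (real n - real k - 1)"
      using nk by (simp add: excess_def subfactorial_eq_sum of_nat_diff)
    then show "measure_pmf.expectation (fixed_measure n k) (\<lambda>\<sigma>. real (inversions n \<sigma>))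
        = real n * (real n - 1) / 4 - (real k - 1) / 6 * real n
          - ((real k)\<^sup>2 - real k - 1) / 12
          + ((-1) ^ (n - k) / fact (n - k)) / (\<Sum>l=0..n - k. (-1) ^ l / fact l)
            * ((real n - real k - 1) / 12)"
      by (simp only: expectation_inversions[OF nk] times_divide_eq_right)
  qed
next
  \<comment> \<open>The constant 1 / 4 is 3 / 12, with the 3 from
    \<open>abs_excess_le\<close>.\<close>
  have "\<bar>excess (n - k) / 12\<bar> \<le> 1 / 4 * (1 / fact (n - k - 1))"
    if "k \<le> n" "k + 1 \<noteq> n" for n k :: nat
  proof -
    define m where "m = n - k"
    have m: "m \<noteq> 1"
      using that by (auto simp: m_def)
    \<comment> \<open>For \<open>m = 0\<close> the truncated \<open>m - 1\<close> is 0 and both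
      sides equal 1.\<close>
    have "\<bar>real m - 1\<bar> / fact m \<le> 1 / fact (m - 1)"
      by (cases m) (auto simp: divide_simps)
    with abs_excess_le[OF m] show ?thesis
      by (simp add: m_def)
  qed
  then show "\<exists>C :: real. \<forall>n k :: nat. 3 \<le> n \<and> 1 \<le> k \<and> k \<le> n \<and> k + 1 \<noteq> n \<longrightarrow>
      \<bar>measure_pmf.expectation (fixed_measure n k) (\<lambda>\<sigma>. real (inversions n \<sigma>))
        - (real n * (real n - 1) / 4 - (real k - 1) / 6 * real n
           - ((real k)\<^sup>2 - real k - 1) / 12)\<bar>
        \<le> C * (1 / fact (n - k - 1))"
    by (intro exI[of _ "1 / 4"]) (simp add: expectation_inversions)
next
  \<comment> \<open>Here the factor \<open>m - 1\<close> in the bound for \<open>excess m\<close>,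
    with \<open>m = n - k\<close>, is absorbed by \<open>n (n - 1)\<close>, which explains the
    better order \<open>1 / fact (n - k)\<close>. As \<open>j - i - 1\<close> lies between 0 and
    \<open>n - 2\<close>, the last factor is bounded uniformly in \<open>i\<close> and
    \<open>j\<close>.\<close>
  have error: "\<bar>excess (n - k) / (real n * (real n - 1)) * ((real j - real i - 1) / (real n - 2) - 1 / 2)\<bar>
      \<le> 3 * (1 / fact (n - k))"
    if n: "3 \<le> n" and k: "k \<le> n" "k + 1 \<noteq> n" and ij: "1 \<le> i" "i < j" "j \<le> n" for n k i j :: nat
  proof -
    have m: "n - k \<noteq> 1"
      using k by auto
    have "\<bar>excess (n - k) / (real n * (real n - 1))\<bar> = \<bar>excess (n - k)\<bar> / (real n * (real n - 1))"
      using n by (simp add: abs_mult)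
    also have "\<dots> \<le> (3 * \<bar>real (n - k) - 1\<bar> / fact (n - k)) / (real n * (real n - 1))"
      using n abs_excess_le[OF m] by (intro divide_right_mono) auto
    also have "\<dots> = 3 * (\<bar>real (n - k) - 1\<bar> / (real n * (real n - 1))) / fact (n - k)"
      by simp
    also have "\<dots> \<le> 3 * 1 / fact (n - k)"
    proof -
      have "\<bar>real (n - k) - 1\<bar> \<le> real n * 1"
        using n k by (simp add: abs_le_iff)
      also have "\<dots> \<le> real n * (real n - 1)"
        using n by (intro mult_left_mono) auto
      finally have "\<bar>real (n - k) - 1\<bar> / (real n * (real n - 1)) \<le> 1"
        using n by (simp add: divide_le_eq_1)
      then show ?thesis
        by (intro divide_right_mono mult_left_mono) auto
    qed
    finally have 1: "\<bar>excess (n - k) / (real n * (real n - 1))\<bar> \<le> 3 / fact (n - k)"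
      by simp
    have "0 \<le> (real j - real i - 1) / (real n - 2)" "(real j - real i - 1) / (real n - 2) \<le> 1"
      using n ij by (auto simp: divide_le_eq_1)
    then have "\<bar>(real j - real i - 1) / (real n - 2) - 1 / 2\<bar> \<le> 1"
      by linarith
    with 1 have "\<bar>excess (n - k) / (real n * (real n - 1))\<bar>
        * \<bar>(real j - real i - 1) / (real n - 2) - 1 / 2\<bar> \<le> 3 / fact (n - k) * 1"
      by (intro mult_mono) auto
    then show ?thesis
      by (simp add: abs_mult)
  qed
  show "\<exists>C :: real. \<forall>n k i j :: nat. 3 \<le> n \<and> 1 \<le> k \<and> k \<le> n \<and> k + 1 \<noteq> n \<and>
        1 \<le> i \<and> i < j \<and> j \<le> n \<longrightarrow>
      \<bar>measure_pmf.prob (fixed_measure n k) {\<sigma>. inv \<sigma> i < inv \<sigma> j}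
        - (1 / 2 + 1 / (2 * real n * (real n - 1) * (real n - 2))
            * ((2 * (real k - 1) * (real j - real i) + (real k)\<^sup>2 - 3 * real k + 1) * real n
               - 2 * ((real k)\<^sup>2 - real k - 1) * (real j - real i)))\<bar>
        \<le> C * (1 / fact (n - k))"
  proof (intro exI[of _ 3] allI impI, elim conjE)
    fix n k i j :: nat
    assume *: "3 \<le> n" "k \<le> n" "k + 1 \<noteq> n" "1 \<le> i" "i < j" "j \<le> n"
    show "\<bar>measure_pmf.prob (fixed_measure n k) {\<sigma>. inv \<sigma> i < inv \<sigma> j}
        - (1 / 2 + 1 / (2 * real n * (real n - 1) * (real n - 2))
            * ((2 * (real k - 1) * (real j - real i) + (real k)\<^sup>2 - 3 * real k + 1) * real n
               - 2 * ((real k)\<^sup>2 - real k - 1) * (real j - real i)))\<bar>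
        \<le> 3 * (1 / fact (n - k))"
      unfolding prob_inv_less[OF *(2,3)] proportion_less_images[OF *] add_diff_cancel_left'
      by (rule error[OF *])
  qed
qed

end
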